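(* Let $v_\delta \in \mathbb V$ and $\alpha > 0$. Then the following hold: (a) Existence: the functional $\mathcal S_{\alpha, v_\delta}$ has at least one minimizer. (b) Stability: Let $(v_k)_{k\in\mathbb N} \in \mathbb V^{\mathbb N}$ satisfy $v_k \to v_\delta$ and choose $\xi_k \in \arg\min \mathcal S_{\alpha, v_k}$ for each $k$. Then $(\xi_k)_{k\in\mathbb N}$ has a convergent subsequence, and the limit of every convergent subsequence is a minimizer of $\mathcal S_{\alpha, v_\delta}$.
   Context: Setting and standing assumptions: $\mathbb U$ and $\mathbb V$ are Hilbert spaces; $\mathbf K \colon \mathbb U \to \mathbb V$ is linear and bounded; $\Lambda$ is an at most countable set; for every $\alpha>0$ a (possibly non-linear) map $\mathbf D_\alpha \colon \ell^2(\Lambda) \to \mathbb U$ is given which is weakly sequentially continuous; $\mathbf w = (w_\lambda)_{\lambda\in\Lambda} \in (0,\infty)^\Lambda$ satisfies $\inf_{\lambda\in\Lambda} w_\lambda > 0$. The weighted $\ell^1$-norm is $\|\xi\|_{1,\mathbf w} = \sum_{\lambda\in\Lambda} w_\lambda |\xi_\lambda| \in [0,\infty]$ for $\xi\in\ell^2(\Lambda)$. For $\alpha>0$ and $v \in \mathbb V$ the deep synthesis functional $\mathcal S_{\alpha,v} \colon \ell^2(\Lambda) \to [0,\infty]$ is $$\mathcal S_{\alpha,v}(\xi) = \|(\mathbf K\circ \mathbf D_\alpha)(\xi) - v\|_{\mathbb V}^2 + \alpha \|\xi\|_{1,\mathbf w}.$$ Convergence of sequences is norm convergence (in $\mathbb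 V$, respectively $\ell^2(\Lambda)$). *)

theory Defs
  imports "HOL-Analysis.Analysis"
begin

text \<open>
  Hilbert spaces are types of class \<open>{real_inner, complete_space}\<close>. A complex Hilbert space is
  covered through its underlying real structure (inner product \<open>Re \<langle>x, y\<rangle>\<close>): norm, convergence
  and weak convergence are unchanged, and complex linear maps are real linear.

  The scalar type \<open>'k :: {real_normed_field, euclidean_space}\<close> of the coefficient sequences
  stands for the real or the complex numbers.
\<close>

text \<open>Sequences over \<open>L\<close> are functions on the whole index type that vanish outside \<open>L\<close>, so that
  equality of elements is equality of functions.\<close>

definition ell2 :: "'i set \<Rightarrow> ('i \<Rightarrow> 'k :: {real_normed_field, euclidean_space}) set" where
  "ell2 L = {\<xi>. (\<forall>l. l \<notin> L \<longrightarrow> \<xi> l = 0) \<and> (\<lambda>l. (norm (\<xi> l))\<^sup>2) summable_on L}"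

definition ell2_norm :: "'i set \<Rightarrow> ('i \<Rightarrow> 'k :: {real_normed_field, euclidean_space}) \<Rightarrow> real" where
  "ell2_norm L \<xi> = sqrt (\<Sum>\<^sub>\<infinity>l\<in>L. (norm (\<xi> l))\<^sup>2)"

definition ell2_tendsto ::
  "'i set \<Rightarrow> (nat \<Rightarrow> 'i \<Rightarrow> 'k :: {real_normed_field, euclidean_space}) \<Rightarrow> ('i \<Rightarrow> 'k) \<Rightarrow> bool" where
  "ell2_tendsto L x \<xi> \<longleftrightarrow> (\<lambda>n. ell2_norm L (\<lambda>l. x n l - \<xi> l)) \<longlonglongrightarrow> 0"

definition ell2_functional ::
  "'i set \<Rightarrow> (('i \<Rightarrow> 'k :: {real_normed_field, euclidean_space}) \<Rightarrow> real) \<Rightarrow> bool" where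
  "ell2_functional L f \<longleftrightarrow>
     (\<forall>\<xi>\<in>ell2 L. \<forall>\<eta>\<in>ell2 L. f (\<lambda>l. \<xi> l + \<eta> l) = f \<xi> + f \<eta>) \<and>
     (\<forall>c. \<forall>\<xi>\<in>ell2 L. f (\<lambda>l. c *\<^sub>R \<xi> l) = c * f \<xi>) \<and>
     (\<exists>C. \<forall>\<xi>\<in>ell2 L. \<bar>f \<xi>\<bar> \<le> C * ell2_norm L \<xi>)"

text \<open>Real-valued functionals suffice over the complex numbers as well: a complex linear
  functional \<open>f\<close> is determined by the real parts of \<open>f\<close> and \<open>\<i> * f\<close>, and every bounded real
  linear functional is such a real part.\<close>

definition ell2_weakly_tendsto ::
  "'i set \<Rightarrow> (nat \<Rightarrow> 'i \<Rightarrow> 'k :: {real_normed_field, euclidean_space}) \<Rightarrow> ('i \<Rightarrow> 'k) \<Rightarrow> bool" where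
  "ell2_weakly_tendsto L x \<xi> \<longleftrightarrow> (\<forall>f. ell2_functional L f \<longrightarrow> (\<lambda>n. f (x n)) \<longlonglongrightarrow> f \<xi>)"

definition weakly_tendsto :: "(nat \<Rightarrow> 'a :: real_normed_vector) \<Rightarrow> 'a \<Rightarrow> bool" where
  "weakly_tendsto x a \<longleftrightarrow> (\<forall>f :: 'a \<Rightarrow> real. bounded_linear f \<longrightarrow> (\<lambda>n. f (x n)) \<longlonglongrightarrow> f a)"

definition weakly_seq_continuous ::
  "'i set \<Rightarrow> (('i \<Rightarrow> 'k :: {real_normed_field, euclidean_space}) \<Rightarrow> 'u :: real_normed_vector)
     \<Rightarrow> bool" where
  "weakly_seq_continuous L D \<longleftrightarrow>
     (\<forall>x. \<forall>\<xi>\<in>ell2 L. (\<forall>n. x n \<in> ell2 L) \<longrightarrow> ell2_weakly_tendsto L x \<xi> \<longrightarrow>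
        weakly_tendsto (\<lambda>n. D (x n)) (D \<xi>))"

definition weighted_l1_norm ::
  "'i set \<Rightarrow> ('i \<Rightarrow> real) \<Rightarrow> ('i \<Rightarrow> 'k :: {real_normed_field, euclidean_space}) \<Rightarrow> ennreal" where
  "weighted_l1_norm L w \<xi> = (\<Sum>\<^sub>\<infinity>l\<in>L. ennreal (w l * norm (\<xi> l)))"

definition synthesis_functional ::
  "'i set \<Rightarrow> ('i \<Rightarrow> real) \<Rightarrow> ('u :: real_normed_vector \<Rightarrow> 'v :: real_normed_vector)
     \<Rightarrow> (real \<Rightarrow> ('i \<Rightarrow> 'k :: {real_normed_field, euclidean_space}) \<Rightarrow> 'u)
     \<Rightarrow> real \<Rightarrow> 'v \<Rightarrow> ('i \<Rightarrow> 'k) \<Rightarrow> ennreal" where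
  "synthesis_functional L w K D \<alpha> v \<xi> =
     ennreal ((norm ((K \<circ> D \<alpha>) \<xi> - v))\<^sup>2) + ennreal \<alpha> * weighted_l1_norm L w \<xi>"

definition synthesis_minimizer ::
  "'i set \<Rightarrow> ('i \<Rightarrow> real) \<Rightarrow> ('u :: real_normed_vector \<Rightarrow> 'v :: real_normed_vector)
     \<Rightarrow> (real \<Rightarrow> ('i \<Rightarrow> 'k :: {real_normed_field, euclidean_space}) \<Rightarrow> 'u)
     \<Rightarrow> real \<Rightarrow> 'v \<Rightarrow> ('i \<Rightarrow> 'k) \<Rightarrow> bool" where
  "synthesis_minimizer L w K D \<alpha> v \<xi> \<longleftrightarrow>
     is_arg_min (synthesis_functional L w K D \<alpha> v) (\<lambda>\<eta>. \<eta> \<in> ell2 L) \<xi>"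

end

theory Submission
  imports Defs "HOL-Complex_Analysis.Great_Picard"
begin

text \<open>
  The proof is the direct method. Since the weights are bounded below by some \<open>m > 0\<close>, a bound on
  the functional bounds the weighted norm, hence the \<open>l1\<close> norm of the coefficients. A diagonal
  subsequence then converges in every coordinate, its limit has finite \<open>l1\<close> norm by Fatou, and the
  convergence is weak in \<open>l2\<close> (\<open>weighted_l1_bounded_subsequence\<close>). No representation of the dual of
  \<open>l2\<close> is needed: a bounded functional exceeds \<open>\<epsilon>\<close> somewhere on the coordinate unit sphere
  for only finitely many coordinates, so on an \<open>l1\<close> bounded set it is controlled by finitely many coordinates up to a
  multiple of \<open>\<epsilon>\<close>.

  The functional is jointly lower semicontinuous for weak convergence of the coefficients and norm
  convergence of the data (\<open>synthesis_functional_lsc\<close>): the residuals converge weakly and the norm is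
  weakly lower semicontinuous, and Fatou applies to the penalty. This makes the weak limit of a
  minimizing sequence, and the weak limit of minimizers for converging data, a minimizer.

  For stability weak convergence has to be improved to norm convergence. Comparing the values at
  the minimizers with the value at their weak limit \<open>\<zeta>\<close> for the same data shows that the upper limit
  of the penalties is at most the penalty at \<open>\<zeta>\<close>. With coordinatewise convergence,
  Scheffe's lemma yields convergence in the weighted \<open>l1\<close> norm, which dominates \<open>m\<close> times the \<open>l2\<close>
  norm.
\<close>

section \<open>Coefficient spaces\<close>

lemma zero_mem_ell2: "(\<lambda>l. 0) \<in> ell2 L"
  by (simp add: ell2_def)

lemma ell2_norm_nonneg: "0 \<le> ell2_norm L x"
  unfolding ell2_norm_def by (intro real_sqrt_ge_zero infsum_nonneg) simp

lemma ell2_diff: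
  assumes x: "x \<in> ell2 L" and y: "y \<in> ell2 L"
  shows "(\<lambda>l. x l - y l) \<in> ell2 L"
proof -
  have "(\<lambda>l. 2 * (norm (x l))\<^sup>2 + 2 * (norm (y l))\<^sup>2) summable_on L"
    using assms by (intro summable_on_add summable_on_cmult_right) (auto simp: ell2_def)
  moreover have "(norm (x l - y l))\<^sup>2 \<le> 2 * (norm (x l))\<^sup>2 + 2 * (norm (y l))\<^sup>2" for l
  proof -
    have "(norm (x l - y l))\<^sup>2 \<le> (norm (x l) + norm (y l))\<^sup>2"
      by (intro power_mono norm_triangle_ineq4) simp
    also have "\<dots> \<le> 2 * (norm (x l))\<^sup>2 + 2 * (norm (y l))\<^sup>2"
      using sum_squares_bound[of "norm (x l)" "norm (y l)"]
      by (simp add: power2_sum)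
    finally show ?thesis .
  qed
  ultimately have "(\<lambda>l. (norm (x l - y l))\<^sup>2) summable_on L"
    by (rule summable_on_comparison_test) auto
  then show ?thesis
    using assms by (simp add: ell2_def)
qed

lemma norm_le_ell2_norm:
  assumes "x \<in> ell2 L"
  shows "norm (x l) \<le> ell2_norm L x"
proof (cases "l \<in> L")
  case True
  have "(norm (x l))\<^sup>2 = (\<Sum>j\<in>{l}. (norm (x j))\<^sup>2)"
    by simp
  also have "\<dots> \<le> (\<Sum>\<^sub>\<infinity>j\<in>L. (norm (x j))\<^sup>2)"
    using assms True by (intro finite_sum_le_infsum) (auto simp: ell2_def)
  finally show ?thesis
    unfolding ell2_norm_def by (rule real_le_rsqrt)
next
  case False
  then show ?thesis
    using assms by (simp add: ell2_def ell2_norm_nonneg)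
qed

lemma ell2_finite_support:
  assumes "finite G" "G \<subseteq> L"
  shows "(\<lambda>l. if l \<in> G then u l else 0) \<in> ell2 L"
    and "ell2_norm L (\<lambda>l. if l \<in> G then u l else 0) = sqrt (\<Sum>l\<in>G. (norm (u l))\<^sup>2)"
proof -
  let ?x = "\<lambda>l. if l \<in> G then u l else 0"
  have "(\<lambda>l. (norm (?x l))\<^sup>2) summable_on L \<longleftrightarrow> (\<lambda>l. (norm (u l))\<^sup>2) summable_on G"
    using assms by (intro summable_on_cong_neutral) auto
  then show "?x \<in> ell2 L"
    using assms by (auto simp: ell2_def)
  have "(\<Sum>\<^sub>\<infinity>l\<in>L. (norm (?x l))\<^sup>2) = (\<Sum>\<^sub>\<infinity>l\<in>G. (norm (u l))\<^sup>2)"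
    using assms by (intro infsum_cong_neutral) auto
  then show "ell2_norm L ?x = sqrt (\<Sum>l\<in>G. (norm (u l))\<^sup>2)"
    using assms by (simp add: ell2_norm_def)
qed

lemma abs_summable_imp_ell2:
  assumes supp: "\<And>l. l \<notin> L \<Longrightarrow> x l = 0" and sm: "(\<lambda>l. norm (x l)) summable_on L"
  shows "x \<in> ell2 L" and "ell2_norm L x \<le> (\<Sum>\<^sub>\<infinity>l\<in>L. norm (x l))"
proof -
  define S where "S = (\<Sum>\<^sub>\<infinity>l\<in>L. norm (x l))"
  have S0: "S \<ge> 0"
    unfolding S_def by (intro infsum_nonneg) simp
  have sq: "(norm (x l))\<^sup>2 \<le> S * norm (x l)" if "l \<in> L" for l
  proof -
    have "(\<Sum>j\<in>{l}. norm (x j)) \<le> S"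
      unfolding S_def using that sm by (intro finite_sum_le_infsum) auto
    then show ?thesis
      by (simp add: power2_eq_square mult_right_mono)
  qed
  have sm': "(\<lambda>l. S * norm (x l)) summable_on L"
    using sm by (rule summable_on_cmult_right)
  have sm2: "(\<lambda>l. (norm (x l))\<^sup>2) summable_on L"
    by (rule summable_on_comparison_test[OF sm' sq]) auto
  then show "x \<in> ell2 L"
    using supp by (simp add: ell2_def)
  have "(\<Sum>\<^sub>\<infinity>l\<in>L. (norm (x l))\<^sup>2) \<le> (\<Sum>\<^sub>\<infinity>l\<in>L. S * norm (x l))"
    using sm2 sm' sq by (rule infsum_mono)
  also have "\<dots> = S\<^sup>2"
    unfolding S_def by (simp add: infsum_cmult_right' power2_eq_square)
  finally show "ell2_norm L x \<le> (\<Sum>\<^sub>\<infinity>l\<in>L. norm (x l))"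
    unfolding ell2_norm_def S_def[symmetric] using S0 by (simp add: real_le_lsqrt)
qed

section \<open>Bounded functionals and weak convergence\<close>

lemma ell2_functional_bound:
  assumes "ell2_functional L f"
  obtains C where "C > 0" "\<And>x. x \<in> ell2 L \<Longrightarrow> \<bar>f x\<bar> \<le> C * ell2_norm L x"
proof -
  obtain C where C: "\<And>x. x \<in> ell2 L \<Longrightarrow> \<bar>f x\<bar> \<le> C * ell2_norm L x"
    using assms unfolding ell2_functional_def by blast
  have "\<bar>f x\<bar> \<le> (\<bar>C\<bar> + 1) * ell2_norm L x" if "x \<in> ell2 L" for x
    using C[OF that] mult_right_mono[of C "\<bar>C\<bar> + 1" "ell2_norm L x"] ell2_norm_nonneg[of L x]
    by linarith
  then show ?thesis
    by (intro that[of "\<bar>C\<bar> + 1"]) auto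
qed

lemma ell2_functional_add:
  "\<lbrakk>ell2_functional L f; x \<in> ell2 L; y \<in> ell2 L\<rbrakk> \<Longrightarrow> f (\<lambda>l. x l + y l) = f x + f y"
  by (simp add: ell2_functional_def)

lemma ell2_functional_scaleR:
  "\<lbrakk>ell2_functional L f; x \<in> ell2 L\<rbrakk> \<Longrightarrow> f (\<lambda>l. c *\<^sub>R x l) = c * f x"
  by (simp add: ell2_functional_def)

lemma ell2_functional_zero:
  assumes "ell2_functional L f"
  shows "f (\<lambda>l. 0) = 0"
  using ell2_functional_scaleR[OF assms zero_mem_ell2, of 0] by simp

lemma ell2_functional_diff:
  assumes f: "ell2_functional L f" and x: "x \<in> ell2 L" and y: "y \<in> ell2 L"
  shows "f (\<lambda>l. x l - y l) = f x - f y"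
  using ell2_functional_add[OF f ell2_diff[OF x y] y] by simp

lemma ell2_functional_finite_support:
  assumes f: "ell2_functional L f" and "finite G" "G \<subseteq> L"
  shows "f (\<lambda>l. if l \<in> G then u l else 0) = (\<Sum>l\<in>G. f (\<lambda>j. if j = l then u l else 0))"
  using assms(2,3)
proof (induction G)
  case empty
  then show ?case
    using ell2_functional_zero[OF f] by simp
next
  case (insert a G)
  have a: "(\<lambda>j. if j = a then u a else 0) \<in> ell2 L"
    using ell2_finite_support(1)[of "{a}" L "\<lambda>_. u a"] insert by simp
  have G: "(\<lambda>l. if l \<in> G then u l else 0) \<in> ell2 L"
    using insert by (intro ell2_finite_support) auto
  have "(\<lambda>l. if l \<in> insert a G then u l else 0) =
        (\<lambda>l. (if l = a then u a else 0) + (if l \<in> G then u l else 0))"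
    using insert by auto
  then have "f (\<lambda>l. if l \<in> insert a G then u l else 0) =
      f (\<lambda>l. if l = a then u a else 0) + f (\<lambda>l. if l \<in> G then u l else 0)"
    using ell2_functional_add[OF f a G] by simp
  then show ?case
    using insert by simp
qed

text \<open>A bounded functional tends to zero along the coordinate directions: unit vectors in \<open>N\<close>
  different coordinates, on each of which it exceeds \<open>\<epsilon>\<close>, add up to a vector of norm \<open>sqrt N\<close> with
  value at least \<open>N * \<epsilon>\<close>.\<close>

lemma finite_large_coordinates:
  fixes f :: "('i \<Rightarrow> 'k :: {real_normed_field, euclidean_space}) \<Rightarrow> real"
  assumes f: "ell2_functional L f" and e: "\<epsilon> > 0"
  shows "finite {l \<in> L. \<exists>u. norm u = 1 \<and> f (\<lambda>j. if j = l then u else 0) > \<epsilon>}" (is "finite ?F")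
proof -
  obtain C where C: "C > 0" "\<And>x. x \<in> ell2 L \<Longrightarrow> \<bar>f x\<bar> \<le> C * ell2_norm L x"
    using ell2_functional_bound[OF f] by blast
  have "\<forall>l\<in>?F. \<exists>u. norm u = 1 \<and> f (\<lambda>j. if j = l then u else 0) > \<epsilon>"
    by simp
  from bchoice[OF this]
  obtain u where u: "\<forall>l\<in>?F. norm (u l) = 1 \<and> f (\<lambda>j. if j = l then u l else 0) > \<epsilon>" ..
  have "card G \<le> nat \<lceil>(C / \<epsilon>)\<^sup>2\<rceil>" if G: "G \<subseteq> ?F" "finite G" for G
  proof (cases "G = {}")
    case False
    let ?x = "\<lambda>l. if l \<in> G then u l else 0"
    have GL: "G \<subseteq> L"
      using G by auto
    have nrm: "ell2_norm L ?x = sqrt (card G)"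
      using ell2_finite_support(2)[OF G(2) GL, of u] G u by (simp add: subset_iff)
    have "card G * \<epsilon> = (\<Sum>l\<in>G. \<epsilon>)"
      by simp
    also have "\<dots> \<le> (\<Sum>l\<in>G. f (\<lambda>j. if j = l then u l else 0))"
      using G u by (intro sum_mono) (auto intro!: less_imp_le)
    also have "\<dots> = f ?x"
      using ell2_functional_finite_support[OF f G(2) GL] by simp
    also have "\<dots> \<le> C * sqrt (card G)"
      using C(2)[OF ell2_finite_support(1)[OF G(2) GL, of u]] nrm by simp
    finally have "sqrt (card G) * sqrt (card G) * \<epsilon> \<le> C * sqrt (card G)"
      by simp
    then have "sqrt (card G) * (sqrt (card G) * \<epsilon>) \<le> sqrt (card G) * C"
      by (simp only: ac_simps)
    then have "sqrt (card G) * \<epsilon> \<le> C"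
      using False G by (simp add: card_gt_0_iff)
    then have "sqrt (card G) \<le> C / \<epsilon>"
      using e by (simp add: pos_le_divide_eq)
    then have "(sqrt (card G))\<^sup>2 \<le> (C / \<epsilon>)\<^sup>2"
      by (intro power_mono) auto
    then have "real (card G) \<le> (C / \<epsilon>)\<^sup>2"
      by simp
    then show ?thesis
      by linarith
  qed simp
  then show ?thesis
    using finite_if_finite_subsets_card_bdd by blast
qed

lemma ell2_functional_small_coordinate:
  fixes f :: "('i \<Rightarrow> 'k :: {real_normed_field, euclidean_space}) \<Rightarrow> real"
  assumes f: "ell2_functional L f" and l: "l \<in> L"
    and small: "\<And>u. norm u = 1 \<Longrightarrow> f (\<lambda>j. if j = l then u else 0) \<le> \<epsilon>"
  shows "\<bar>f (\<lambda>j. if j = l then u else 0)\<bar> \<le> \<epsilon> * norm u"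
proof (cases "u = 0")
  case True
  then show ?thesis
    using ell2_functional_zero[OF f] by (simp cong: if_cong)
next
  case False
  have mem: "(\<lambda>j. if j = l then v else 0) \<in> ell2 L" for v :: 'k
    using ell2_finite_support(1)[of "{l}" L "\<lambda>_. v"] l by simp
  have scale: "f (\<lambda>j. if j = l then c *\<^sub>R v else 0) = c * f (\<lambda>j. if j = l then v else 0)"
    for c and v :: 'k
    using ell2_functional_scaleR[OF f mem, of c v] by (simp add: if_distrib cong: if_cong)
  define n where "n = norm u"
  have n: "n > 0"
    using False by (simp add: n_def)
  have "f (\<lambda>j. if j = l then (1 / n) *\<^sub>R u else 0) \<le> \<epsilon>"
    and "f (\<lambda>j. if j = l then (- 1 / n) *\<^sub>R u else 0) \<le> \<epsilon>"
    using n by (auto intro!: small simp: n_def)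
  then show ?thesis
    unfolding scale n_def[symmetric] using n by (simp add: abs_le_iff field_simps)
qed

text \<open>Splitting off the finitely many coordinates in \<open>F\<close>, on which only the norm bound \<open>C\<close> is
  available, the remaining part of \<open>f y\<close> costs at most \<open>\<epsilon>\<close> times the \<open>l1\<close> norm.\<close>

lemma ell2_functional_le_l1:
  fixes f :: "('i \<Rightarrow> 'k :: {real_normed_field, euclidean_space}) \<Rightarrow> real"
  assumes f: "ell2_functional L f"
    and C: "C > 0" "\<And>x. x \<in> ell2 L \<Longrightarrow> \<bar>f x\<bar> \<le> C * ell2_norm L x"
    and F: "finite F" "F \<subseteq> L"
    and small: "\<And>l u. \<lbrakk>l \<in> L - F; norm u = 1\<rbrakk> \<Longrightarrow> f (\<lambda>j. if j = l then u else 0) \<le> \<epsilon>"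
    and e: "\<epsilon> > 0"
    and supp: "\<And>l. l \<notin> L \<Longrightarrow> y l = 0" and sm: "(\<lambda>l. norm (y l)) summable_on L"
  shows "\<bar>f y\<bar> \<le> C * (\<Sum>l\<in>F. norm (y l)) + \<epsilon> * (\<Sum>\<^sub>\<infinity>l\<in>L. norm (y l))"
proof (rule field_le_epsilon)
  fix e :: real assume e0: "e > 0"
  let ?S = "\<Sum>\<^sub>\<infinity>l\<in>L. norm (y l)"
  obtain G0 where G0: "finite G0" "G0 \<subseteq> L" "dist (\<Sum>l\<in>G0. norm (y l)) ?S \<le> e / C"
    using infsum_finite_approximation[OF sm, of "e / C"] e0 C by auto
  define G where "G = G0 \<union> F"
  have G: "finite G" "G \<subseteq> L"
    using G0 F by (auto simp: G_def)
  have "(\<Sum>l\<in>G0. norm (y l)) \<le> (\<Sum>l\<in>G. norm (y l))"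
    using G by (intro sum_mono2) (auto simp: G_def)
  then have GS: "?S - (\<Sum>l\<in>G. norm (y l)) \<le> e / C"
    using G0(3) by (simp add: dist_real_def)
  have GS': "(\<Sum>l\<in>G. norm (y l)) \<le> ?S"
    using sm G by (intro finite_sum_le_infsum) auto
  let ?g = "\<lambda>l. if l \<in> G then y l else 0"
  \<comment> \<open>\<open>?g\<close> is a finite truncation of \<open>y\<close> containing \<open>F\<close>; the tail \<open>z\<close> is small in \<open>l1\<close>, hence in
    \<open>l2\<close>, and is estimated by continuity of \<open>f\<close>.\<close>
  define z where "z = (\<lambda>l. y l - ?g l)"
  have smg: "((\<lambda>l. norm (?g l)) has_sum (\<Sum>l\<in>G. norm (y l))) L"
  proof -
    have "((\<lambda>l. norm (y l)) has_sum (\<Sum>l\<in>G. norm (y l))) G"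
      using G by (simp add: has_sum_finite)
    then show ?thesis
      by (rule has_sum_cong_neutral[THEN iffD1, rotated -1]) (use G in auto)
  qed
  have "((\<lambda>l. norm (y l) - norm (?g l)) has_sum (?S - (\<Sum>l\<in>G. norm (y l)))) L"
    using has_sum_add[OF has_sum_infsum[OF sm] has_sum_uminusI[OF smg]] by simp
  moreover have "norm (y l) - norm (?g l) = norm (z l)" for l
    by (simp add: z_def)
  ultimately have smz: "((\<lambda>l. norm (z l)) has_sum (?S - (\<Sum>l\<in>G. norm (y l)))) L"
    by simp
  have y2: "y \<in> ell2 L"
    using supp sm by (rule abs_summable_imp_ell2)
  have g2: "?g \<in> ell2 L"
    using G by (rule ell2_finite_support)
  have z2: "z \<in> ell2 L"
    unfolding z_def using y2 g2 by (rule ell2_diff)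
  have z1: "ell2_norm L z \<le> e / C"
  proof -
    have "ell2_norm L z \<le> (\<Sum>\<^sub>\<infinity>l\<in>L. norm (z l))"
      using supp smz by (intro abs_summable_imp_ell2) (auto simp: z_def has_sum_imp_summable)
    also have "\<dots> = ?S - (\<Sum>l\<in>G. norm (y l))"
      using smz by (rule infsumI)
    finally show ?thesis
      using GS by simp
  qed
  have "\<bar>f z\<bar> \<le> C * (e / C)"
    using C(2)[OF z2] z1 C(1) by (smt (verit) mult_left_mono)
  then have fz: "\<bar>f z\<bar> \<le> e"
    using C by simp
  have coord: "\<bar>f (\<lambda>j. if j = l then y l else 0)\<bar>
      \<le> (if l \<in> F then C * norm (y l) else 0) + \<epsilon> * norm (y l)" if "l \<in> G" for l
  proof (cases "l \<in> F")
    case True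
    have "\<bar>f (\<lambda>j. if j = l then y l else 0)\<bar> \<le> C * norm (y l)"
      using C(2)[of "\<lambda>j. if j = l then y l else 0"] ell2_finite_support[of "{l}" L "\<lambda>_. y l"]
        G that by auto
    moreover have "0 \<le> \<epsilon> * norm (y l)"
      using e by simp
    ultimately show ?thesis
      using True by simp
  next
    case False
    then show ?thesis
      using ell2_functional_small_coordinate[OF f, of l \<epsilon> "y l"] small[of l] G that by auto
  qed
  have "\<bar>f ?g\<bar> \<le> (\<Sum>l\<in>G. \<bar>f (\<lambda>j. if j = l then y l else 0)\<bar>)"
    unfolding ell2_functional_finite_support[OF f G] by (rule sum_abs)
  also have "\<dots> \<le> (\<Sum>l\<in>G. (if l \<in> F then C * norm (y l) else 0) + \<epsilon> * norm (y l))"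
    using coord by (rule sum_mono)
  also have "\<dots> = (\<Sum>l\<in>G. if l \<in> F then C * norm (y l) else 0) + \<epsilon> * (\<Sum>l\<in>G. norm (y l))"
    by (simp add: sum.distrib sum_distrib_left)
  also have "(\<Sum>l\<in>G. if l \<in> F then C * norm (y l) else 0) = (\<Sum>l\<in>F. C * norm (y l))"
    using G by (intro sum.mono_neutral_cong_right) (auto simp: G_def)
  also have "\<epsilon> * (\<Sum>l\<in>G. norm (y l)) \<le> \<epsilon> * ?S"
    using e GS' by simp
  finally have "\<bar>f ?g\<bar> \<le> C * (\<Sum>l\<in>F. norm (y l)) + \<epsilon> * ?S"
    by (simp add: sum_distrib_left)
  moreover have "f z = f y - f ?g"
    unfolding z_def using f y2 g2 by (rule ell2_functional_diff)
  ultimately show "\<bar>f y\<bar> \<le> C * (\<Sum>l\<in>F. norm (y l)) + \<epsilon> * ?S + e"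
    using fz by linarith
qed

text \<open>On a set that is bounded in the \<open>l1\<close> norm, coordinatewise convergence implies weak convergence
  in \<open>l2\<close>, because a functional is uniformly small off finitely many coordinates.\<close>

lemma l1_bounded_pointwise_imp_weakly:
  fixes x :: "nat \<Rightarrow> 'i \<Rightarrow> 'k :: {real_normed_field, euclidean_space}"
  assumes supp: "\<And>n l. l \<notin> L \<Longrightarrow> x n l = 0" "\<And>l. l \<notin> L \<Longrightarrow> \<zeta> l = 0"
    and sm: "\<And>n. (\<lambda>l. norm (x n l)) summable_on L" "(\<lambda>l. norm (\<zeta> l)) summable_on L"
    and bd: "\<And>n. (\<Sum>\<^sub>\<infinity>l\<in>L. norm (x n l)) \<le> B"
    and pw: "\<And>l. l \<in> L \<Longrightarrow> (\<lambda>n. x n l) \<longlonglongrightarrow> \<zeta> l"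
  shows "ell2_weakly_tendsto L x \<zeta>"
  unfolding ell2_weakly_tendsto_def
proof (intro allI impI)
  fix f :: "('i \<Rightarrow> 'k) \<Rightarrow> real" assume f: "ell2_functional L f"
  obtain C where C: "C > 0" "\<And>x. x \<in> ell2 L \<Longrightarrow> \<bar>f x\<bar> \<le> C * ell2_norm L x"
    using ell2_functional_bound[OF f] by blast
  let ?Z = "\<Sum>\<^sub>\<infinity>l\<in>L. norm (\<zeta> l)"
  define d where "d n l = x n l - \<zeta> l" for n l
  have sm_add: "(\<lambda>l. norm (x n l) + norm (\<zeta> l)) summable_on L" for n
    using sm by (intro summable_on_add)
  have smd: "(\<lambda>l. norm (d n l)) summable_on L" for n
    by (rule summable_on_comparison_test[OF sm_add[of n]]) (auto simp: d_def norm_triangle_ineq4)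
  have bdd: "(\<Sum>\<^sub>\<infinity>l\<in>L. norm (d n l)) \<le> B + ?Z" for n
  proof -
    have "(\<Sum>\<^sub>\<infinity>l\<in>L. norm (d n l)) \<le> (\<Sum>\<^sub>\<infinity>l\<in>L. norm (x n l) + norm (\<zeta> l))"
      using smd sm_add by (rule infsum_mono) (auto simp: d_def norm_triangle_ineq4)
    also have "\<dots> = (\<Sum>\<^sub>\<infinity>l\<in>L. norm (x n l)) + ?Z"
      using sm by (intro infsum_add)
    finally show ?thesis
      using bd[of n] by simp
  qed
  have Z0: "?Z \<ge> 0"
    by (intro infsum_nonneg) simp
  have B0: "0 \<le> B"
    using bd[of 0] infsum_nonneg[of L "\<lambda>l. norm (x 0 l)"] by simp
  have fd: "f (d n) = f (x n) - f \<zeta>" for n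
    unfolding d_def using f supp sm
    by (intro ell2_functional_diff abs_summable_imp_ell2(1)) auto
  show "(\<lambda>n. f (x n)) \<longlonglongrightarrow> f \<zeta>"
  proof (rule tendstoI)
    fix e :: real assume e: "e > 0"
    define \<epsilon> where "\<epsilon> = e / (2 * (B + ?Z + 1))"
    have eps: "\<epsilon> > 0"
      using e B0 Z0 by (simp add: \<epsilon>_def)
    have eps2: "\<epsilon> * (B + ?Z) < e / 2"
      using e B0 Z0 by (simp add: \<epsilon>_def field_simps)
    define F where "F = {l \<in> L. \<exists>u. norm u = 1 \<and> f (\<lambda>j. if j = l then u else 0) > \<epsilon>}"
    have F: "finite F" "F \<subseteq> L"
      using finite_large_coordinates[OF f eps] by (auto simp: F_def)
    have "(\<lambda>n. C * (\<Sum>l\<in>F. norm (d n l))) \<longlonglongrightarrow> C * (\<Sum>l\<in>F. norm (\<zeta> l - \<zeta> l))"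
      unfolding d_def using F pw by (intro tendsto_intros) auto
    then have "\<forall>\<^sub>F n in sequentially. C * (\<Sum>l\<in>F. norm (d n l)) < e / 2"
      using e by (intro order_tendstoD) auto
    then show "\<forall>\<^sub>F n in sequentially. dist (f (x n)) (f \<zeta>) < e"
    proof eventually_elim
      case (elim n)
      have "\<bar>f (d n)\<bar> \<le> C * (\<Sum>l\<in>F. norm (d n l)) + \<epsilon> * (\<Sum>\<^sub>\<infinity>l\<in>L. norm (d n l))"
        using f C F _ eps _ smd
        by (rule ell2_functional_le_l1) (use supp in \<open>auto simp: F_def d_def not_less\<close>)
      also have "\<dots> \<le> C * (\<Sum>l\<in>F. norm (d n l)) + \<epsilon> * (B + ?Z)"
        using bdd[of n] eps by simp
      finally show ?case
        using elim eps2 by (simp add: fd dist_real_def)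
    qed
  qed
qed

lemma ell2_tendsto_imp_weakly:
  assumes x: "\<And>n. x n \<in> ell2 L" and z: "\<zeta> \<in> ell2 L" and lim: "ell2_tendsto L x \<zeta>"
  shows "ell2_weakly_tendsto L x \<zeta>"
  unfolding ell2_weakly_tendsto_def
proof (intro allI impI)
  fix f :: "('a \<Rightarrow> 'b) \<Rightarrow> real" assume f: "ell2_functional L f"
  obtain C where C: "C > 0" "\<And>x. x \<in> ell2 L \<Longrightarrow> \<bar>f x\<bar> \<le> C * ell2_norm L x"
    using ell2_functional_bound[OF f] by blast
  have "(\<lambda>n. C * ell2_norm L (\<lambda>l. x n l - \<zeta> l)) \<longlonglongrightarrow> C * 0"
    using lim unfolding ell2_tendsto_def by (intro tendsto_intros)
  moreover have "\<bar>f (x n) - f \<zeta>\<bar> \<le> C * ell2_norm L (\<lambda>l. x n l - \<zeta> l)" for n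
    using C(2)[OF ell2_diff[OF x z]] ell2_functional_diff[OF f x z] by simp
  ultimately have "(\<lambda>n. f (x n) - f \<zeta>) \<longlonglongrightarrow> 0"
    by (intro Lim_null_comparison[where f = "\<lambda>n. f (x n) - f \<zeta>"]) auto
  then show "(\<lambda>n. f (x n)) \<longlonglongrightarrow> f \<zeta>"
    by (rule LIM_zero_cancel)
qed

lemma ell2_weakly_imp_pointwise:
  fixes x :: "nat \<Rightarrow> 'i \<Rightarrow> 'k :: {real_normed_field, euclidean_space}"
  assumes lim: "ell2_weakly_tendsto L x \<zeta>"
  shows "(\<lambda>n. x n l) \<longlonglongrightarrow> \<zeta> l"
proof -
  have "(\<lambda>n. x n l \<bullet> b) \<longlonglongrightarrow> \<zeta> l \<bullet> b" if b: "b \<in> Basis" for b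
  proof -
    have "ell2_functional L (\<lambda>y. y l \<bullet> b)"
      unfolding ell2_functional_def
    proof (intro conjI exI[of _ 1] ballI)
      fix y :: "'i \<Rightarrow> 'k" assume "y \<in> ell2 L"
      then show "\<bar>y l \<bullet> b\<bar> \<le> 1 * ell2_norm L y"
        using norm_le_ell2_norm[of y L l] Basis_le_norm[OF b, of "y l"] by simp
    qed (auto simp: inner_add_left)
    then show ?thesis
      using lim unfolding ell2_weakly_tendsto_def by blast
  qed
  then show ?thesis
    by (subst tendsto_componentwise_iff) auto
qed


section \<open>Weighted l1 norm\<close>

lemma infsum_ennreal_eq_nn_integral:
  fixes f :: "'a \<Rightarrow> ennreal"
  assumes "countable A"
  shows "(\<Sum>\<^sub>\<infinity>x\<in>A. f x) = (\<integral>\<^sup>+x. f x \<partial>count_space A)"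
proof (rule antisym)
  have part: "sum f F = (\<integral>\<^sup>+x. f x * indicator F x \<partial>count_space A)" if "finite F" "F \<subseteq> A" for F
  proof -
    have "(\<integral>\<^sup>+x. f x * indicator F x \<partial>count_space A) = (\<Sum>x\<in>F. f x * indicator F x)"
      using that by (intro nn_integral_count_space') auto
    then show ?thesis
      by simp
  qed
  show "(\<Sum>\<^sub>\<infinity>x\<in>A. f x) \<le> (\<integral>\<^sup>+x. f x \<partial>count_space A)"
  proof (rule infsum_le_finite_sums)
    fix F assume "finite F" "F \<subseteq> A"
    then show "sum f F \<le> (\<integral>\<^sup>+x. f x \<partial>count_space A)"
      unfolding part[OF \<open>finite F\<close> \<open>F \<subseteq> A\<close>]
      by (intro nn_integral_mono) (auto simp: indicator_def)
  qed (simp add: nonneg_summable_on_complete)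
  \<comment> \<open>Monotone convergence along an exhaustion of \<open>A\<close> by finite sets; this uses countability.\<close>
  obtain F where F: "\<And>n. finite (F n)" "incseq F" "(\<Union>n::nat. F n) = A"
  proof (cases "A = {}")
    case True
    then show ?thesis
      by (intro that[of "\<lambda>_. {}"]) (auto simp: incseq_def)
  next
    case False
    show ?thesis
    proof (rule that[of "\<lambda>n. from_nat_into A ` {..<n}"])
      have "(\<Union>n. from_nat_into A ` {..<n}) = range (from_nat_into A)"
        by auto
      then show "(\<Union>n. from_nat_into A ` {..<n}) = A"
        using False assms by (simp add: range_from_nat_into)
    qed (auto simp: incseq_def intro!: image_mono)
  qed
  have "(\<integral>\<^sup>+x. f x \<partial>count_space A) = (\<integral>\<^sup>+x. (SUP n. f x * indicator (F n) x) \<partial>count_space A)"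
  proof (intro nn_integral_cong antisym)
    fix x assume "x \<in> space (count_space A)"
    then obtain n where "x \<in> F n"
      using F(3) by auto
    then show "f x \<le> (SUP n. f x * indicator (F n) x)"
      by (intro SUP_upper2[of n]) auto
    show "(SUP n. f x * indicator (F n) x) \<le> f x"
      by (intro SUP_least) (auto simp: indicator_def)
  qed
  also have "\<dots> = (SUP n. \<integral>\<^sup>+x. f x * indicator (F n) x \<partial>count_space A)"
    using F(2) by (intro nn_integral_monotone_convergence_SUP)
      (auto simp: incseq_def le_fun_def indicator_def)
  also have "\<dots> \<le> (\<Sum>\<^sub>\<infinity>x\<in>A. f x)"
  proof (rule SUP_least)
    fix n
    have FA: "F n \<subseteq> A"
      using F(3) by auto
    show "(\<integral>\<^sup>+x. f x * indicator (F n) x \<partial>count_space A) \<le> (\<Sum>\<^sub>\<infinity>x\<in>A. f x)"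
      unfolding part[OF F(1) FA, symmetric] using F(1) FA
      by (subst nonneg_infsum_complete) (auto intro!: SUP_upper)
  qed
  finally show "(\<integral>\<^sup>+x. f x \<partial>count_space A) \<le> (\<Sum>\<^sub>\<infinity>x\<in>A. f x)" .
qed

lemma weighted_l1_norm_eq_nn_integral:
  assumes "countable L" and w: "\<forall>l\<in>L. w l > 0"
  shows "weighted_l1_norm L w x = (\<integral>\<^sup>+l. norm (w l *\<^sub>R x l) \<partial>count_space L)"
  unfolding weighted_l1_norm_def infsum_ennreal_eq_nn_integral[OF assms(1)]
  using w by (intro nn_integral_cong) (simp add: less_imp_le)

lemma weighted_l1_norm_zero: "weighted_l1_norm L w (\<lambda>l. 0) = 0"
  by (simp add: weighted_l1_norm_def)

lemma weighted_l1_finite_imp_summable: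
  assumes m: "m > 0" "\<forall>l\<in>L. m \<le> w l"
    and bd: "weighted_l1_norm L w x \<le> ennreal B" and B: "0 \<le> B"
  shows "(\<lambda>l. norm (x l)) summable_on L" and "(\<Sum>\<^sub>\<infinity>l\<in>L. norm (x l)) \<le> B / m"
proof -
  have part: "(\<Sum>l\<in>F. norm (x l)) \<le> B / m" if F: "finite F" "F \<subseteq> L" for F
  proof -
    have "ennreal (\<Sum>l\<in>F. m * norm (x l)) \<le> ennreal (\<Sum>l\<in>F. w l * norm (x l))"
      using F m by (intro ennreal_leI sum_mono mult_right_mono) auto
    also have "\<dots> = (\<Sum>l\<in>F. ennreal (w l * norm (x l)))"
    proof (rule sum_ennreal[symmetric])
      fix l assume "l \<in> F"
      then have "m \<le> w l"
        using F m by auto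
      then show "0 \<le> w l * norm (x l)"
        using m(1) by simp
    qed
    also have "\<dots> \<le> weighted_l1_norm L w x"
      unfolding weighted_l1_norm_def using F
      by (subst nonneg_infsum_complete) (auto intro!: SUP_upper)
    also note bd
    finally have "m * (\<Sum>l\<in>F. norm (x l)) \<le> B"
      using B by (simp add: sum_distrib_left)
    then show ?thesis
      using m(1) by (simp add: field_simps)
  qed
  show "(\<lambda>l. norm (x l)) summable_on L"
    using part by (intro nonneg_bdd_above_summable_on bdd_aboveI2) auto
  then show "(\<Sum>\<^sub>\<infinity>l\<in>L. norm (x l)) \<le> B / m"
    using part by (rule infsum_le_finite_sums)
qed

lemma ell2_norm_le_weighted:
  assumes m: "m > 0" "\<forall>l\<in>L. m \<le> w l"
    and supp: "\<And>l. l \<notin> L \<Longrightarrow> x l = 0"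
  shows "ennreal (m * ell2_norm L x) \<le> weighted_l1_norm L w x"
proof (cases "weighted_l1_norm L w x")
  case (real B)
  then have "(\<lambda>l. norm (x l)) summable_on L" "(\<Sum>\<^sub>\<infinity>l\<in>L. norm (x l)) \<le> B / m"
    using weighted_l1_finite_imp_summable[OF m, of x B] by simp_all
  then have "ell2_norm L x \<le> B / m"
    using abs_summable_imp_ell2(2)[of L x] supp by fastforce
  then show ?thesis
    using real m(1) by (simp add: field_simps)
qed simp

lemma weighted_l1_norm_lsc:
  fixes x :: "nat \<Rightarrow> 'i \<Rightarrow> 'k :: {real_normed_field, euclidean_space}"
  assumes L: "countable L" and w: "\<forall>l\<in>L. w l > 0"
    and pw: "\<And>l. l \<in> L \<Longrightarrow> (\<lambda>n. x n l) \<longlonglongrightarrow> \<zeta> l"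
  shows "weighted_l1_norm L w \<zeta> \<le> liminf (\<lambda>n. weighted_l1_norm L w (x n))"
proof -
  have "(\<integral>\<^sup>+l. norm (w l *\<^sub>R \<zeta> l) \<partial>count_space L)
      = (\<integral>\<^sup>+l. liminf (\<lambda>n. ennreal (norm (w l *\<^sub>R x n l))) \<partial>count_space L)"
  proof (rule nn_integral_cong)
    fix l assume "l \<in> space (count_space L)"
    then have "(\<lambda>n. ennreal (norm (w l *\<^sub>R x n l))) \<longlonglongrightarrow> ennreal (norm (w l *\<^sub>R \<zeta> l))"
      using pw by (intro tendsto_intros) simp
    then show "ennreal (norm (w l *\<^sub>R \<zeta> l)) = liminf (\<lambda>n. ennreal (norm (w l *\<^sub>R x n l)))"
      by (intro lim_imp_Liminf[symmetric]) auto
  qed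
  also have "\<dots> \<le> liminf (\<lambda>n. \<integral>\<^sup>+l. norm (w l *\<^sub>R x n l) \<partial>count_space L)"
    by (rule nn_integral_liminf) simp
  finally show ?thesis
    by (simp only: weighted_l1_norm_eq_nn_integral[OF L w])
qed

text \<open>The weighted norm has the Radon--Riesz property for coordinatewise convergence; this is
  Scheffe's lemma for counting measure.\<close>

lemma weighted_l1_Radon_Riesz:
  fixes x :: "nat \<Rightarrow> 'i \<Rightarrow> 'k :: {real_normed_field, euclidean_space}"
  assumes L: "countable L" and w: "\<forall>l\<in>L. w l > 0"
    and pw: "\<And>l. l \<in> L \<Longrightarrow> (\<lambda>n. x n l) \<longlonglongrightarrow> \<zeta> l"
    and fin: "\<And>n. weighted_l1_norm L w (x n) < \<infinity>" "weighted_l1_norm L w \<zeta> < \<infinity>"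
    and lim: "limsup (\<lambda>n. weighted_l1_norm L w (x n)) \<le> weighted_l1_norm L w \<zeta>"
  shows "(\<lambda>n. weighted_l1_norm L w (\<lambda>l. x n l - \<zeta> l)) \<longlonglongrightarrow> 0"
proof -
  note eq = weighted_l1_norm_eq_nn_integral[OF L w]
  have "(\<lambda>n. \<integral>\<^sup>+l. norm (w l *\<^sub>R x n l - w l *\<^sub>R \<zeta> l) \<partial>count_space L) \<longlonglongrightarrow> 0"
  proof (rule Scheffe_lemma1)
    show "integrable (count_space L) (\<lambda>l. w l *\<^sub>R x n l)" for n
      using fin(1)[of n] by (intro integrableI_bounded) (auto simp: eq)
    show "integrable (count_space L) (\<lambda>l. w l *\<^sub>R \<zeta> l)"
      using fin(2) by (intro integrableI_bounded) (auto simp: eq)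
    show "AE l in count_space L. (\<lambda>n. w l *\<^sub>R x n l) \<longlonglongrightarrow> w l *\<^sub>R \<zeta> l"
      using pw by (auto simp: AE_count_space intro!: tendsto_intros)
    show "limsup (\<lambda>n. \<integral>\<^sup>+l. norm (w l *\<^sub>R x n l) \<partial>count_space L)
        \<le> (\<integral>\<^sup>+l. norm (w l *\<^sub>R \<zeta> l) \<partial>count_space L)"
      using lim by (simp only: eq)
  qed
  then show ?thesis
    by (simp only: eq scaleR_diff_right)
qed

text \<open>Sequential compactness of weighted \<open>l1\<close> balls for the weak topology of \<open>l2\<close>.\<close>

lemma weighted_l1_bounded_subsequence:
  fixes x :: "nat \<Rightarrow> 'i \<Rightarrow> 'k :: {real_normed_field, euclidean_space}"
  assumes L: "countable L"
    and m: "m > 0" "\<forall>l\<in>L. m \<le> w l"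
    and x: "\<And>n. x n \<in> ell2 L"
    and bd: "\<And>n. weighted_l1_norm L w (x n) \<le> ennreal B" and B: "0 \<le> B"
  obtains r \<zeta> where "strict_mono (r :: nat \<Rightarrow> nat)" "\<zeta> \<in> ell2 L"
    "ell2_weakly_tendsto L (x \<circ> r) \<zeta>"
proof -
  have w: "\<forall>l\<in>L. w l > 0"
    using m by (auto intro: less_le_trans)
  have sm: "(\<lambda>l. norm (x n l)) summable_on L" "(\<Sum>\<^sub>\<infinity>l\<in>L. norm (x n l)) \<le> B / m" for n
    using weighted_l1_finite_imp_summable[OF m bd B] by auto
  have nb: "norm (x n l) \<le> B / m" for n l
    using norm_le_ell2_norm[OF x, of n l] abs_summable_imp_ell2(2)[of L "x n"] sm[of n] x[of n]
    by (force simp: ell2_def)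
  obtain r where r: "strict_mono (r :: nat \<Rightarrow> nat)"
    "\<And>l. l \<in> L \<Longrightarrow> \<exists>z. (\<lambda>n. x (r n) l) \<longlonglongrightarrow> z"
    using function_convergent_subsequence[OF L, of x "B / m"] nb by blast
  define \<zeta> where "\<zeta> l = (if l \<in> L then lim (\<lambda>n. x (r n) l) else 0)" for l
  have pw: "(\<lambda>n. x (r n) l) \<longlonglongrightarrow> \<zeta> l" if "l \<in> L" for l
    using r(2)[OF that] that by (auto simp: \<zeta>_def limI)
  have "weighted_l1_norm L w \<zeta> \<le> liminf (\<lambda>n. weighted_l1_norm L w (x (r n)))"
    using L w pw by (rule weighted_l1_norm_lsc)
  also have "\<dots> \<le> ennreal B"
    using bd by (intro Liminf_le) auto
  finally have z: "(\<lambda>l. norm (\<zeta> l)) summable_on L"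
    using weighted_l1_finite_imp_summable(1)[OF m _ B] by blast
  have z2: "\<zeta> \<in> ell2 L"
    using z by (intro abs_summable_imp_ell2) (auto simp: \<zeta>_def)
  have "ell2_weakly_tendsto L (x \<circ> r) \<zeta>"
    by (rule l1_bounded_pointwise_imp_weakly[where B = "B / m"])
      (use x sm z pw in \<open>auto simp: \<zeta>_def ell2_def\<close>)
  then show ?thesis
    using that r z2 by blast
qed

section \<open>Lower semicontinuity of the synthesis functional\<close>

text \<open>Testing the weak limit \<open>a\<close> against itself and applying Cauchy--Schwarz shows that the norm is
  weakly lower semicontinuous.\<close>

lemma weakly_tendsto_norm_lsc:
  fixes a :: "'a :: real_inner"
  assumes lim: "weakly_tendsto x a" and t: "t < (norm a)\<^sup>2"
  shows "\<forall>\<^sub>F n in sequentially. t < (norm (x n))\<^sup>2"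
proof (cases "t < 0")
  case True
  then show ?thesis
    by (intro always_eventually allI) (smt (verit) zero_le_power2)
next
  case False
  have st: "sqrt t < norm a"
    using t by (intro real_less_lsqrt) auto
  have s0: "sqrt t \<ge> 0"
    using False by simp
  have "(\<lambda>n. x n \<bullet> a) \<longlonglongrightarrow> a \<bullet> a"
    using lim bounded_linear_inner_left unfolding weakly_tendsto_def by blast
  moreover have "sqrt t * norm a < a \<bullet> a"
    using st s0 by (auto simp: dot_square_norm power2_eq_square intro!: mult_strict_right_mono
        intro: le_less_trans)
  ultimately have "\<forall>\<^sub>F n in sequentially. sqrt t * norm a < x n \<bullet> a"
    by (rule order_tendstoD)
  then show ?thesis
  proof eventually_elim
    case (elim n)
    then have "sqrt t * norm a < norm (x n) * norm a"
      using norm_cauchy_schwarz[of "x n" a] by simp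
    then have "sqrt t < norm (x n)"
      by (rule mult_right_less_imp_less) simp
    then have "(sqrt t)\<^sup>2 < (norm (x n))\<^sup>2"
      using s0 by (intro power_strict_mono) auto
    then show ?case
      using False by simp
  qed
qed

lemma residual_weakly_tendsto:
  fixes K :: "'u :: real_normed_vector \<Rightarrow> 'v :: real_normed_vector"
  assumes K: "bounded_linear K" and D: "weakly_seq_continuous L D"
    and x: "\<And>n. x n \<in> ell2 L" "\<zeta> \<in> ell2 L" "ell2_weakly_tendsto L x \<zeta>"
    and v: "v \<longlonglongrightarrow> v0"
  shows "weakly_tendsto (\<lambda>n. K (D (x n)) - v n) (K (D \<zeta>) - v0)"
  unfolding weakly_tendsto_def
proof (intro allI impI)
  fix f :: "'v \<Rightarrow> real" assume f: "bounded_linear f"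
  have "bounded_linear (\<lambda>u. f (K u))"
    using f K by (rule bounded_linear_compose)
  moreover have "weakly_tendsto (\<lambda>n. D (x n)) (D \<zeta>)"
    using D x unfolding weakly_seq_continuous_def by blast
  ultimately have "(\<lambda>n. f (K (D (x n)))) \<longlonglongrightarrow> f (K (D \<zeta>))"
    unfolding weakly_tendsto_def by blast
  then have "(\<lambda>n. f (K (D (x n))) - f (v n)) \<longlonglongrightarrow> f (K (D \<zeta>)) - f v0"
    by (intro tendsto_diff bounded_linear.tendsto[OF f v])
  then show "(\<lambda>n. f (K (D (x n)) - v n)) \<longlonglongrightarrow> f (K (D \<zeta>) - v0)"
    using f by (simp add: linear_diff bounded_linear.linear)
qed

lemma liminf_add_cmult_ennreal:
  fixes u v :: "nat \<Rightarrow> ennreal"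
  shows "liminf u + c * liminf v \<le> liminf (\<lambda>n. u n + c * v n)"
proof -
  have inc: "incseq (\<lambda>n. INF k\<in>{n..}. u k)" "incseq (\<lambda>n. c * (INF k\<in>{n..}. v k))"
    by (auto simp: incseq_def intro!: INF_superset_mono mult_left_mono)
  have "liminf u + c * liminf v = (SUP n. (INF k\<in>{n..}. u k) + c * (INF k\<in>{n..}. v k))"
    unfolding liminf_SUP_INF SUP_mult_left_ennreal using inc by (rule ennreal_SUP_add[symmetric])
  also have "\<dots> \<le> (SUP n. INF k\<in>{n..}. u k + c * v k)"
    by (intro SUP_mono' INF_greatest add_mono mult_left_mono INF_lower) auto
  finally show ?thesis
    unfolding liminf_SUP_INF .
qed

lemma synthesis_functional_lsc:
  fixes K :: "'u :: real_normed_vector \<Rightarrow> 'v :: real_inner"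
    and D :: "real \<Rightarrow> ('i \<Rightarrow> 'k :: {real_normed_field, euclidean_space}) \<Rightarrow> 'u"
  assumes K: "bounded_linear K" and L: "countable L" and D: "weakly_seq_continuous L (D \<alpha>)"
    and w: "\<forall>l\<in>L. w l > 0"
    and x: "\<And>n. x n \<in> ell2 L" "\<zeta> \<in> ell2 L" "ell2_weakly_tendsto L x \<zeta>"
    and v: "v \<longlonglongrightarrow> v0"
  shows "synthesis_functional L w K D \<alpha> v0 \<zeta>
    \<le> liminf (\<lambda>n. synthesis_functional L w K D \<alpha> (v n) (x n))"
proof -
  have "ennreal ((norm (K (D \<alpha> \<zeta>) - v0))\<^sup>2)
      \<le> liminf (\<lambda>n. ennreal ((norm (K (D \<alpha> (x n)) - v n))\<^sup>2))"
    unfolding le_Liminf_iff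
  proof (intro allI impI)
    fix y assume "y < ennreal ((norm (K (D \<alpha> \<zeta>) - v0))\<^sup>2)"
    then obtain t where t: "y = ennreal t" "0 \<le> t" "t < (norm (K (D \<alpha> \<zeta>) - v0))\<^sup>2"
      by (cases y) (auto simp: ennreal_less_iff)
    show "\<forall>\<^sub>F n in sequentially. y < ennreal ((norm (K (D \<alpha> (x n)) - v n))\<^sup>2)"
      using weakly_tendsto_norm_lsc[OF residual_weakly_tendsto[OF K D x v] t(3)]
      by eventually_elim (use t in \<open>simp add: ennreal_less_iff\<close>)
  qed
  moreover have "weighted_l1_norm L w \<zeta> \<le> liminf (\<lambda>n. weighted_l1_norm L w (x n))"
    using L w ell2_weakly_imp_pointwise[OF x(3)] by (rule weighted_l1_norm_lsc)
  ultimately have "synthesis_functional L w K D \<alpha> v0 \<zeta> \<le>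
      liminf (\<lambda>n. ennreal ((norm (K (D \<alpha> (x n)) - v n))\<^sup>2))
      + ennreal \<alpha> * liminf (\<lambda>n. weighted_l1_norm L w (x n))"
    unfolding synthesis_functional_def by (auto intro!: add_mono mult_left_mono)
  also have "\<dots> \<le> liminf (\<lambda>n. synthesis_functional L w K D \<alpha> (v n) (x n))"
    unfolding synthesis_functional_def o_def by (rule liminf_add_cmult_ennreal)
  finally show ?thesis .
qed

lemma synthesis_functional_data_continuous:
  assumes "v \<longlonglongrightarrow> v0"
  shows "(\<lambda>n. synthesis_functional L w K D \<alpha> (v n) \<eta>) \<longlonglongrightarrow> synthesis_functional L w K D \<alpha> v0 \<eta>"
  unfolding synthesis_functional_def using assms by (intro tendsto_intros)

section \<open>Existence and stability of minimizers\<close>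

lemma synthesis_minimizer_iff:
  "synthesis_minimizer L w K D \<alpha> v \<xi> \<longleftrightarrow>
    \<xi> \<in> ell2 L \<and> (\<forall>\<eta>\<in>ell2 L. synthesis_functional L w K D \<alpha> v \<xi> \<le> synthesis_functional L w K D \<alpha> v \<eta>)"
  unfolding synthesis_minimizer_def is_arg_min_linorder by blast

lemma weak_limit_of_minimizers:
  fixes K :: "'u :: real_normed_vector \<Rightarrow> 'v :: real_inner"
    and D :: "real \<Rightarrow> ('i \<Rightarrow> 'k :: {real_normed_field, euclidean_space}) \<Rightarrow> 'u"
  assumes K: "bounded_linear K" and L: "countable L" and D: "weakly_seq_continuous L (D \<alpha>)"
    and w: "\<forall>l\<in>L. w l > 0"
    and min: "\<And>n. synthesis_minimizer L w K D \<alpha> (v n) (x n)"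
    and z: "\<zeta> \<in> ell2 L" "ell2_weakly_tendsto L x \<zeta>"
    and v: "v \<longlonglongrightarrow> v0"
  shows "synthesis_minimizer L w K D \<alpha> v0 \<zeta>"
  unfolding synthesis_minimizer_iff
proof (intro conjI ballI z)
  fix \<eta> :: "'i \<Rightarrow> 'k" assume eta: "\<eta> \<in> ell2 L"
  let ?S = "synthesis_functional L w K D \<alpha>"
  have x: "x n \<in> ell2 L" and le: "?S (v n) (x n) \<le> ?S (v n) \<eta>" for n
    using min[of n] eta by (auto simp: synthesis_minimizer_iff)
  have "?S v0 \<zeta> \<le> liminf (\<lambda>n. ?S (v n) (x n))"
    using K L D w x z v by (rule synthesis_functional_lsc)
  also have "\<dots> \<le> liminf (\<lambda>n. ?S (v n) \<eta>)"
    using le by (intro Liminf_mono) auto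
  also have "\<dots> = ?S v0 \<eta>"
    using synthesis_functional_data_continuous[OF v] by (intro lim_imp_Liminf) auto
  finally show "?S v0 \<zeta> \<le> ?S v0 \<eta>" .
qed

text \<open>Coercivity: sequences on which the functional is bounded, for arbitrary data, have weakly
  convergent subsequences.\<close>

lemma synthesis_sublevel_subsequence:
  fixes K :: "'u :: real_normed_vector \<Rightarrow> 'v :: real_inner"
    and D :: "real \<Rightarrow> ('i \<Rightarrow> 'k :: {real_normed_field, euclidean_space}) \<Rightarrow> 'u"
  assumes L: "countable L"
    and m: "m > 0" "\<forall>l\<in>L. m \<le> w l" and \<alpha>: "\<alpha> > 0"
    and x: "\<And>n. x n \<in> ell2 L"
    and bd: "\<And>n. synthesis_functional L w K D \<alpha> (v n) (x n) \<le> ennreal c" and c: "0 \<le> c"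
  obtains r \<zeta> where "strict_mono (r :: nat \<Rightarrow> nat)" "\<zeta> \<in> ell2 L"
    "ell2_weakly_tendsto L (x \<circ> r) \<zeta>"
proof -
  have W: "weighted_l1_norm L w (x n) \<le> ennreal (c / \<alpha>)" for n
  proof -
    have le: "ennreal \<alpha> * weighted_l1_norm L w (x n) \<le> ennreal c"
      using order_trans[OF _ bd[of n]] by (simp add: synthesis_functional_def)
    show ?thesis
    proof (cases "weighted_l1_norm L w (x n)")
      case (real b)
      then have "\<alpha> * b \<le> c"
        using le \<alpha> c by (simp add: ennreal_mult[symmetric])
      then show ?thesis
        using real \<alpha> by (simp add: ennreal_leI field_simps)
    next
      case top
      then show ?thesis
        using le \<alpha> by (simp add: ennreal_mult_top top_unique)
    qed
  qed
  have "0 \<le> c / \<alpha>"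
    using c \<alpha> by simp
  then obtain r \<zeta> where "strict_mono (r :: nat \<Rightarrow> nat)" "\<zeta> \<in> ell2 L"
    "ell2_weakly_tendsto L (x \<circ> r) \<zeta>"
    using weighted_l1_bounded_subsequence[where x = x, OF L m x W] by blast
  then show ?thesis
    by (rule that)
qed

lemma exists_synthesis_minimizer:
  fixes K :: "'u :: real_normed_vector \<Rightarrow> 'v :: real_inner"
    and D :: "real \<Rightarrow> ('i \<Rightarrow> 'k :: {real_normed_field, euclidean_space}) \<Rightarrow> 'u"
  assumes K: "bounded_linear K" and L: "countable L" and D: "weakly_seq_continuous L (D \<alpha>)"
    and m: "m > 0" "\<forall>l\<in>L. m \<le> w l" and \<alpha>: "\<alpha> > 0"
  shows "\<exists>\<xi>. synthesis_minimizer L w K D \<alpha> v0 \<xi>"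
proof -
  let ?S = "synthesis_functional L w K D \<alpha> v0"
  have w: "\<forall>l\<in>L. w l > 0"
    using m by (auto intro: less_le_trans)
  define I where "I = Inf (?S ` ell2 L)"
  define c where "c = (norm (K (D \<alpha> (\<lambda>l. 0)) - v0))\<^sup>2 + 1"
  have "I \<le> ?S (\<lambda>l. 0)"
    unfolding I_def by (intro INF_lower zero_mem_ell2)
  also have "\<dots> < ennreal c"
    by (simp add: synthesis_functional_def weighted_l1_norm_zero c_def ennreal_less_iff)
  finally have Ic: "I < ennreal c" .
  obtain u where u: "\<And>n. u n \<in> ?S ` ell2 L" "u \<longlonglongrightarrow> I"
    using Inf_as_limit[of "?S ` ell2 L"] zero_mem_ell2[of L] unfolding I_def by blast
  \<comment> \<open>Discarding the first \<open>N\<close> terms puts the whole minimizing sequence into one sublevel set.\<close>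
  obtain N where N: "\<And>n. n \<ge> N \<Longrightarrow> u n < ennreal c"
    using order_tendstoD(2)[OF u(2) Ic] unfolding eventually_sequentially by blast
  have "\<forall>n. \<exists>y. y \<in> ell2 L \<and> u (n + N) = ?S y"
    using u(1) by blast
  then obtain x where x: "\<And>n. x n \<in> ell2 L" "\<And>n. u (n + N) = ?S (x n)"
    by metis
  have bd: "?S (x n) \<le> ennreal c" for n
    using N[of "n + N"] x(2)[of n] by simp
  obtain r \<zeta> where r: "strict_mono (r :: nat \<Rightarrow> nat)" "\<zeta> \<in> ell2 L"
    "ell2_weakly_tendsto L (x \<circ> r) \<zeta>"
    by (rule synthesis_sublevel_subsequence[OF L m \<alpha> x(1), where v = "\<lambda>_. v0" and c = c])
      (use bd in \<open>auto simp: c_def\<close>)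
  have lim: "(\<lambda>n. ?S ((x \<circ> r) n)) \<longlonglongrightarrow> I"
    using LIMSEQ_subseq_LIMSEQ[OF LIMSEQ_ignore_initial_segment[OF u(2), of N] r(1)] x(2)
    by (simp add: o_def)
  have "?S \<zeta> \<le> liminf (\<lambda>n. ?S ((x \<circ> r) n))"
    using x(1) by (intro synthesis_functional_lsc[where v = "\<lambda>_. v0"] K L D w r) auto
  also have "\<dots> = I"
    using lim by (intro lim_imp_Liminf) auto
  finally have "?S \<zeta> \<le> I" .
  then have "synthesis_minimizer L w K D \<alpha> v0 \<zeta>"
    unfolding synthesis_minimizer_iff I_def using r(2) by (auto intro: order_trans INF_lower)
  then show ?thesis
    by blast
qed

text \<open>Minimality bounds the values of the functional at \<open>x n\<close> by those at \<open>\<zeta>\<close>, which converge. As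
  the residuals are weakly lower semicontinuous, the upper limit of the weighted norms cannot exceed
  the weighted norm of \<open>\<zeta>\<close>, and the Radon--Riesz property turns weak into strong convergence.\<close>

lemma weak_limit_of_minimizers_strong:
  fixes K :: "'u :: real_normed_vector \<Rightarrow> 'v :: real_inner"
    and D :: "real \<Rightarrow> ('i \<Rightarrow> 'k :: {real_normed_field, euclidean_space}) \<Rightarrow> 'u"
  assumes K: "bounded_linear K" and L: "countable L" and D: "weakly_seq_continuous L (D \<alpha>)"
    and m: "m > 0" "\<forall>l\<in>L. m \<le> w l" and \<alpha>: "\<alpha> > 0"
    and min: "\<And>n. synthesis_minimizer L w K D \<alpha> (v n) (x n)"
    and z: "\<zeta> \<in> ell2 L" "ell2_weakly_tendsto L x \<zeta>"
    and v: "v \<longlonglongrightarrow> v0"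
  shows "ell2_tendsto L x \<zeta>"
proof -
  let ?S = "synthesis_functional L w K D \<alpha>" and ?W = "weighted_l1_norm L w"
  define a where "a n = (norm (K (D \<alpha> (x n)) - v n))\<^sup>2" for n
  define A where "A = (norm (K (D \<alpha> \<zeta>) - v0))\<^sup>2"
  define A' where "A' n = (norm (K (D \<alpha> \<zeta>) - v n))\<^sup>2" for n
  have w: "\<forall>l\<in>L. w l > 0"
    using m by (auto intro: less_le_trans)
  have x: "x n \<in> ell2 L" and le: "\<And>\<eta>. \<eta> \<in> ell2 L \<Longrightarrow> ?S (v n) (x n) \<le> ?S (v n) \<eta>" for n
    using min[of n] by (auto simp: synthesis_minimizer_iff)
  have fin_of: "?W y < \<infinity>" if "?S u y \<le> ?S u (\<lambda>l. 0)" for y u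
  proof (cases "?W y")
    case top
    then show ?thesis
      using that \<alpha> by (auto simp: synthesis_functional_def weighted_l1_norm_zero ennreal_mult_top
          top_unique)
  qed simp
  have finx: "?W (x n) < \<infinity>" for n
    using le[OF zero_mem_ell2] by (rule fin_of)
  have "synthesis_minimizer L w K D \<alpha> v0 \<zeta>"
    using K L D w min z v by (rule weak_limit_of_minimizers)
  then have finz: "?W \<zeta> < \<infinity>"
    by (intro fin_of) (auto simp: synthesis_minimizer_iff zero_mem_ell2)
  then obtain B where B: "?W \<zeta> = ennreal B" "0 \<le> B"
    by (cases "?W \<zeta>") auto
  have "limsup (\<lambda>n. ?W (x n)) \<le> ?W \<zeta>"
    unfolding Limsup_le_iff
  proof (intro allI impI)
    fix y assume y: "?W \<zeta> < y"
    show "\<forall>\<^sub>F n in sequentially. ?W (x n) < y"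
    proof (cases y)
      case (real t)
      \<comment> \<open>Half of the available slack goes to the lower bound for the residuals at \<open>x n\<close>, half to
        the upper bound for the residuals at \<open>\<zeta>\<close>.\<close>
      define e where "e = \<alpha> * (t - B) / 2"
      have e: "e > 0"
        using y real B \<alpha> by (simp add: e_def ennreal_less_iff)
      have "\<forall>\<^sub>F n in sequentially. A - e < a n"
        unfolding a_def
        by (rule weakly_tendsto_norm_lsc[OF residual_weakly_tendsto[OF K D x z v]])
          (use e in \<open>simp add: A_def\<close>)
      moreover have "A' \<longlonglongrightarrow> A"
        unfolding A'_def A_def using v by (intro tendsto_intros)
      then have "\<forall>\<^sub>F n in sequentially. A' n < A + e"
        using e by (intro order_tendstoD) auto
      ultimately show ?thesis
      proof eventually_elim
        case (elim n)
        obtain b where b: "?W (x n) = ennreal b" "0 \<le> b"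
          using finx[of n] by (cases "?W (x n)") auto
        have "ennreal (a n + \<alpha> * b) \<le> ennreal (A' n + \<alpha> * B)"
          using le[OF z(1), of n] b B \<alpha>
          by (simp add: synthesis_functional_def a_def A'_def ennreal_mult)
        then have "a n + \<alpha> * b \<le> A' n + \<alpha> * B"
          using B \<alpha> by (subst (asm) ennreal_le_iff) (auto simp: A'_def)
        then have "\<alpha> * b < \<alpha> * B + 2 * e"
          using elim by simp
        then have "\<alpha> * b < \<alpha> * t"
          by (simp add: e_def field_simps)
        then show ?case
          using b real \<alpha> by (simp add: ennreal_less_iff)
      qed
    qed (use finx in auto)
  qed
  then have W0: "(\<lambda>n. ?W (\<lambda>l. x n l - \<zeta> l)) \<longlonglongrightarrow> 0"
    using L w ell2_weakly_imp_pointwise[OF z(2)] finx finz by (intro weighted_l1_Radon_Riesz)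
  have "ennreal (m * ell2_norm L (\<lambda>l. x n l - \<zeta> l)) \<le> ?W (\<lambda>l. x n l - \<zeta> l)" for n
    using m x[of n] z(1) by (intro ell2_norm_le_weighted) (auto simp: ell2_def)
  then have "(\<lambda>n. ennreal (m * ell2_norm L (\<lambda>l. x n l - \<zeta> l))) \<longlonglongrightarrow> ennreal 0"
    using tendsto_sandwich[OF always_eventually always_eventually tendsto_const W0] by simp
  then have "(\<lambda>n. m * ell2_norm L (\<lambda>l. x n l - \<zeta> l)) \<longlonglongrightarrow> 0"
    using m(1) by (subst (asm) tendsto_ennreal_iff) (auto simp: ell2_norm_nonneg)
  then have "(\<lambda>n. (1 / m) * (m * ell2_norm L (\<lambda>l. x n l - \<zeta> l))) \<longlonglongrightarrow> (1 / m) * 0"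
    by (intro tendsto_intros)
  then show ?thesis
    unfolding ell2_tendsto_def using m(1) by simp
qed

theorem theorem2p3:
  fixes K :: "'u :: {real_inner, complete_space} \<Rightarrow> 'v :: {real_inner, complete_space}"
    and L :: "'i set"
    and D :: "real \<Rightarrow> ('i \<Rightarrow> 'k :: {real_normed_field, euclidean_space}) \<Rightarrow> 'u"
    and w :: "'i \<Rightarrow> real"
    and v\<delta> :: 'v
    and \<alpha> :: real
  assumes K: "bounded_linear K"
    and L: "countable L"
    and D: "\<And>\<beta>. \<beta> > 0 \<Longrightarrow> weakly_seq_continuous L (D \<beta>)"
    and w_pos: "\<And>l. l \<in> L \<Longrightarrow> w l > 0"
    and w_inf: "(INF l\<in>L. ereal (w l)) > 0"
    and \<alpha>: "\<alpha> > 0"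
  shows "(\<exists>\<xi>. synthesis_minimizer L w K D \<alpha> v\<delta> \<xi>) \<and>
    (\<forall>v \<xi>. v \<longlonglongrightarrow> v\<delta> \<longrightarrow> (\<forall>k. synthesis_minimizer L w K D \<alpha> (v k) (\<xi> k)) \<longrightarrow>
       (\<exists>r \<zeta>. strict_mono (r :: nat \<Rightarrow> nat) \<and> \<zeta> \<in> ell2 L \<and> ell2_tendsto L (\<xi> \<circ> r) \<zeta>) \<and>
       (\<forall>r \<zeta>. strict_mono (r :: nat \<Rightarrow> nat) \<and> \<zeta> \<in> ell2 L \<and> ell2_tendsto L (\<xi> \<circ> r) \<zeta>
          \<longrightarrow> synthesis_minimizer L w K D \<alpha> v\<delta> \<zeta>))"
proof -
  obtain m where m0: "0 < ereal m" "ereal m < (INF l\<in>L. ereal (w l))"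
    using ereal_dense2[OF w_inf] by blast
  have m: "m > 0" "\<forall>l\<in>L. m \<le> w l"
    using m0 less_INF_D[OF m0(2)] by (auto intro: less_imp_le)
  have w: "\<forall>l\<in>L. w l > 0"
    using w_pos by blast
  note D\<alpha> = D[OF \<alpha>]
  have "\<exists>r \<zeta>. strict_mono (r :: nat \<Rightarrow> nat) \<and> \<zeta> \<in> ell2 L \<and> ell2_tendsto L (\<xi> \<circ> r) \<zeta>"
    if v: "v \<longlonglongrightarrow> v\<delta>" and min: "\<And>k. synthesis_minimizer L w K D \<alpha> (v k) (\<xi> k)" for v \<xi>
  proof -
    have x: "\<xi> n \<in> ell2 L" for n
      using min[of n] by (simp add: synthesis_minimizer_iff)
    have "(\<lambda>n. K (D \<alpha> (\<lambda>l. 0)) - v n) \<longlonglongrightarrow> K (D \<alpha> (\<lambda>l. 0)) - v\<delta>"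
      using v by (intro tendsto_intros)
    then have "convergent (\<lambda>n. K (D \<alpha> (\<lambda>l. 0)) - v n)"
      by (rule convergentI)
    then have "Bseq (\<lambda>n. K (D \<alpha> (\<lambda>l. 0)) - v n)"
      by (rule convergent_imp_Bseq)
    then obtain c where c: "c > 0" "\<And>n. norm (K (D \<alpha> (\<lambda>l. 0)) - v n) \<le> c"
      by (auto simp: Bseq_def)
    \<comment> \<open>Comparison with the zero sequence, at which the penalty vanishes, bounds the minimal
      values uniformly.\<close>
    have bd: "synthesis_functional L w K D \<alpha> (v n) (\<xi> n) \<le> ennreal (c\<^sup>2)" for n
    proof -
      have "synthesis_functional L w K D \<alpha> (v n) (\<xi> n)
          \<le> synthesis_functional L w K D \<alpha> (v n) (\<lambda>l. 0)"
        using min[of n] by (simp add: synthesis_minimizer_iff zero_mem_ell2)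
      also have "\<dots> \<le> ennreal (c\<^sup>2)"
        using c(2)[of n]
        by (simp add: synthesis_functional_def weighted_l1_norm_zero ennreal_leI power_mono)
      finally show ?thesis .
    qed
    obtain r \<zeta> where r: "strict_mono (r :: nat \<Rightarrow> nat)" "\<zeta> \<in> ell2 L"
      "ell2_weakly_tendsto L (\<xi> \<circ> r) \<zeta>"
      by (rule synthesis_sublevel_subsequence[OF L m \<alpha> x bd]) auto
    have "synthesis_minimizer L w K D \<alpha> ((v \<circ> r) n) ((\<xi> \<circ> r) n)" for n
      by (simp add: min)
    then have "ell2_tendsto L (\<xi> \<circ> r) \<zeta>"
      using r(2,3) LIMSEQ_subseq_LIMSEQ[OF v r(1)]
      by (rule weak_limit_of_minimizers_strong[where D = D and \<alpha> = \<alpha>, OF K L D\<alpha> m \<alpha>])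
    then show ?thesis
      using r by blast
  qed
  moreover have "synthesis_minimizer L w K D \<alpha> v\<delta> \<zeta>"
    if v: "v \<longlonglongrightarrow> v\<delta>" and min: "\<And>k. synthesis_minimizer L w K D \<alpha> (v k) (\<xi> k)"
      and r: "strict_mono (r :: nat \<Rightarrow> nat)" "\<zeta> \<in> ell2 L" "ell2_tendsto L (\<xi> \<circ> r) \<zeta>" for v \<xi> r \<zeta>
  proof -
    have min': "synthesis_minimizer L w K D \<alpha> ((v \<circ> r) n) ((\<xi> \<circ> r) n)" for n
      by (simp add: min)
    then have "ell2_weakly_tendsto L (\<xi> \<circ> r) \<zeta>"
      using r by (intro ell2_tendsto_imp_weakly) (auto simp: synthesis_minimizer_iff)
    with min' r(2) show ?thesis
      using LIMSEQ_subseq_LIMSEQ[OF v r(1)]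
      by (rule weak_limit_of_minimizers[where D = D and \<alpha> = \<alpha>, OF K L D\<alpha> w])
  qed
  ultimately show ?thesis
    using exists_synthesis_minimizer[where D = D and \<alpha> = \<alpha>, OF K L D\<alpha> m \<alpha>] by blast
qed

end
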